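(* For a probability distribution $\boldsymbol p=(p_1,p_2,\ldots)\in\mathbb{R}^{\mathbb{N}}$ on $\mathbb{N}$ and $n\in\mathbb{N}$, put $$\alpha_n(\boldsymbol p)=2\sum_{j:\,p_j<1/n}p_j,\qquad \beta_n(\boldsymbol p)=\frac1{\sqrt n}\sum_{j:\,p_j\ge1/n}\sqrt{p_j}.$$ Let $X_1,\ldots,X_n$ be independent random variables, each distributed according to $\boldsymbol p$, and let $J_n=\sum_{j\in\mathbb{N}}\left|\hat p^{(n)}_j-p_j\right|$, where $\hat p^{(n)}_j$ is the empirical frequency of $j$. Then: (i) For every distribution $\boldsymbol p\in\mathbb{R}^{\mathbb{N}}$, $P\left(J_n>\alpha_n(\boldsymbol p)+\beta_n(\boldsymbol p)+\varepsilon\right)\le\exp(-n\varepsilon^2/2)$ for all $n\in\mathbb{N}$ and $\varepsilon>0$. (ii) For every distribution $\boldsymbol p\in\mathbb{R}^{\mathbb{N}}$, $\alpha_n(\boldsymbol p)+\beta_n(\boldsymbol p)\to0$ as $n\to\infty$. (iii) The rate of decay in (ii) may be arbitrarily slow: for every sequence $1>r_1>r_2>\cdots$ decreasing to $0$, there is a distribution $\boldsymbol p\in\mathbb{R}^{\mathbb{N}}$ such that $\alpha_n(\boldsymbol p)+\beta_n(\boldsymbol p)>r_n$ for all $n\in\mathbb{N}$.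
   Context: $\mathbb{N}=\{1,2,\ldots\}$. A distribution $\boldsymbol p\in\mathbb{R}^{\mathbb{N}}$ is a sequence of nonnegative entries summing to $1$. The empirical frequencies are $\hat p^{(n)}_j=\frac1n\sum_{i=1}^n\mathbf 1_{\{X_i=j\}}$, $j\in\mathbb{N}$. The random variable $J_n$ is the $\ell_1$ distance between the empirical and the true distributions. *)

theory Defs
  imports "HOL-Probability.Probability"
begin

(* The natural numbers of the text start at 1.  Sequences indexed by them are functions on nat
   whose value at 0 is never used; all sums over j range over subsets of {1..}. *)

definition distribution :: "(nat \<Rightarrow> real) \<Rightarrow> bool" where
  "distribution p \<longleftrightarrow> (\<forall>j\<in>{1..}. 0 \<le> p j) \<and> (p has_sum 1) {1..}"

definition alpha :: "nat \<Rightarrow> (nat \<Rightarrow> real) \<Rightarrow> real" where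
  "alpha n p = 2 * (\<Sum>\<^sub>\<infinity>j\<in>{j\<in>{1..}. p j < 1 / real n}. p j)"

(* For a distribution p and n at least 1 the index set is finite, so this is a finite sum. *)
definition beta :: "nat \<Rightarrow> (nat \<Rightarrow> real) \<Rightarrow> real" where
  "beta n p = 1 / sqrt (real n) * (\<Sum>\<^sub>\<infinity>j\<in>{j\<in>{1..}. p j \<ge> 1 / real n}. sqrt (p j))"

definition emp_freq :: "(nat \<Rightarrow> 'a \<Rightarrow> nat) \<Rightarrow> nat \<Rightarrow> nat \<Rightarrow> 'a \<Rightarrow> real" where
  "emp_freq X n j \<omega> = 1 / real n * (\<Sum>i=1..n. of_bool (X i \<omega> = j))"

definition l1_dist :: "(nat \<Rightarrow> real) \<Rightarrow> (nat \<Rightarrow> 'a \<Rightarrow> nat) \<Rightarrow> nat \<Rightarrow> 'a \<Rightarrow> real" where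
  "l1_dist p X n \<omega> = (\<Sum>\<^sub>\<infinity>j\<in>{1..}. \<bar>emp_freq X n j \<omega> - p j\<bar>)"

definition iid_sample ::
  "'a measure \<Rightarrow> (nat \<Rightarrow> real) \<Rightarrow> nat \<Rightarrow> (nat \<Rightarrow> 'a \<Rightarrow> nat) \<Rightarrow> bool" where
  "iid_sample M p n X \<longleftrightarrow>
     prob_space.indep_vars M (\<lambda>_. count_space {1..}) X {1..n} \<and>
     (\<forall>i\<in>{1..n}. distributed M (count_space {1..}) (X i) (\<lambda>j. ennreal (p j)))"

end

theory Submission
  imports Defs
begin

text \<open>
  Termwise, the mean deviation of the empirical frequency of \<open>j\<close> is at most \<open>2 p\<^sub>j\<close> (triangle
  inequality) and at most \<open>sqrt (p\<^sub>j / n)\<close> (variance bound), so the mean of \<open>J\<^sub>n\<close> is at most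
  \<open>\<alpha>\<^sub>n + \<beta>\<^sub>n\<close>. Moving one sample point changes \<open>J\<^sub>n\<close> by at most \<open>2 / n\<close>, so McDiarmid's inequality
  gives (i). Each term of \<open>\<alpha>\<^sub>n + \<beta>\<^sub>n\<close> is at most \<open>2 p\<^sub>j\<close> and tends to 0, so (ii) is dominated
  convergence. For (iii), choose a tail sequence \<open>T\<close> with \<open>T\<^sub>0 = 1\<close> that decreases to 0 so slowly
  that \<open>T\<^sub>n \<ge> r\<^sub>n\<close> and \<open>T\<^sub>j\<^sub>-\<^sub>1 - T\<^sub>j \<le> 1 / j\<close>. With \<open>p\<^sub>j = T\<^sub>j\<^sub>-\<^sub>1 - T\<^sub>j\<close> all \<open>j > n\<close> satisfy
  \<open>p\<^sub>j < 1 / n\<close>, and therefore \<open>\<alpha>\<^sub>n \<ge> 2 T\<^sub>n > r\<^sub>n\<close>.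
\<close>

subsection \<open>McDiarmid's inequality\<close>

lemma (in prob_space) abs_expectation_le_const:
  fixes f :: "'a \<Rightarrow> real"
  assumes "integrable M f" and bound: "\<And>x. x \<in> space M \<Longrightarrow> \<bar>f x\<bar> \<le> B"
  shows "\<bar>expectation f\<bar> \<le> B"
proof -
  have "f x \<le> B" "- B \<le> f x" if "x \<in> space M" for x
    using bound[OF that] by linarith+
  then have "expectation f \<le> B" "- B \<le> expectation f"
    by (auto intro!: integral_le_const integral_ge_const AE_I2 assms)
  then show ?thesis by simp
qed

text \<open>Hoeffding's lemma asks for an interval that contains the values, whereas bounded
  differences control only the oscillation. The interval starts at the infimum. The mean is left
  uncentred, so that the estimate can be iterated under further integrals.\<close>

lemma (in prob_space) Hoeffdings_lemma_bochner:
  fixes f :: "'a \<Rightarrow> real"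
  assumes [measurable]: "random_variable borel f"
    and osc: "\<And>x y. x \<in> space M \<Longrightarrow> y \<in> space M \<Longrightarrow> \<bar>f x - f y\<bar> \<le> c"
    and "l > 0"
  shows "expectation (\<lambda>x. exp (l * f x)) \<le> exp (l * expectation f + l\<^sup>2 * c\<^sup>2 / 8)"
proof -
  define a where "a = (INF x\<in>space M. f x)"
  obtain x0 where x0: "x0 \<in> space M"
    using not_empty by blast
  have "f x0 - c \<le> f x" if "x \<in> space M" for x
    using osc[OF x0 that] by linarith
  then have bdd: "bdd_below (f ` space M)"
    by (auto intro!: bdd_belowI)
  have "a \<le> f x" if "x \<in> space M" for x
    unfolding a_def by (rule cINF_lower[OF bdd that])
  moreover have "f x \<le> a + c" if "x \<in> space M" for x
  proof -
    \<comment> \<open>Each value minus \<open>c\<close> is a lower bound of all values, hence lies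
      below their infimum \<open>a\<close>.\<close>
    have "f x - c \<le> f y" if "y \<in> space M" for y
      using osc[OF \<open>x \<in> space M\<close> that] by linarith
    then have "f x - c \<le> a"
      unfolding a_def by (intro cINF_greatest) (use not_empty in auto)
    then show ?thesis by simp
  qed
  ultimately interpret interval_bounded_random_variable M f a "a + c"
    by unfold_locales auto
  define E where "E = expectation f"
  have int: "integrable M (\<lambda>x. exp (l * (f x - E)))"
  proof (rule integrable_const_bound)
    show "AE x in M. norm (exp (l * (f x - E))) \<le> exp (l * (a + c - E))"
      using AE_in_interval by eventually_elim (use \<open>l > 0\<close> in auto)
  qed simp
  have "ennreal (expectation (\<lambda>x. exp (l * (f x - E)))) = (\<integral>\<^sup>+x. exp (l * (f x - E)) \<partial>M)"
    by (intro nn_integral_eq_integral[symmetric] int) auto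
  also have "\<dots> \<le> ennreal (exp (l\<^sup>2 * c\<^sup>2 / 8))"
    using Hoeffdings_lemma_nn_integral[OF \<open>l > 0\<close>] by (simp add: E_def)
  finally have *: "expectation (\<lambda>x. exp (l * (f x - E))) \<le> exp (l\<^sup>2 * c\<^sup>2 / 8)"
    by simp
  have "expectation (\<lambda>x. exp (l * f x)) = exp (l * E) * expectation (\<lambda>x. exp (l * (f x - E)))"
    by (subst integral_mult_right_zero[symmetric]) (simp add: exp_add[symmetric] algebra_simps)
  also have "\<dots> \<le> exp (l * E) * exp (l\<^sup>2 * c\<^sup>2 / 8)"
    by (intro mult_left_mono *) auto
  finally show ?thesis
    by (simp add: exp_add E_def)
qed

text \<open>Coordinates are integrated out one at a time, in place of a martingale argument. For
  fixed other coordinates, \<open>f\<close> oscillates by at most \<open>c i\<close> in coordinate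
  \<open>i\<close>, so Hoeffding's lemma costs a factor
  \<open>exp (l\<^sup>2 * (c i)\<^sup>2 / 8)\<close> and replaces \<open>f\<close> by its average
  \<open>g\<close>, which inherits the bound \<open>B\<close> and the remaining differences. The
  bound \<open>B\<close> provides integrability only and does not enter the estimate.\<close>

lemma (in product_prob_space) bounded_differences_exp_moment:
  fixes f :: "('i \<Rightarrow> 'a) \<Rightarrow> real"
  assumes "finite J" "f \<in> borel_measurable (Pi\<^sub>M J M)"
    and "\<And>x. x \<in> space (Pi\<^sub>M J M) \<Longrightarrow> \<bar>f x\<bar> \<le> B"
    and "\<And>x i y. x \<in> space (Pi\<^sub>M J M) \<Longrightarrow> i \<in> J \<Longrightarrow> y \<in> space (M i) \<Longrightarrow>
           \<bar>f x - f (x(i := y))\<bar> \<le> c i"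
    and "l > 0"
  shows "(\<integral>x. exp (l * f x) \<partial>Pi\<^sub>M J M) \<le> exp (l * (\<integral>x. f x \<partial>Pi\<^sub>M J M) + l\<^sup>2 * (\<Sum>i\<in>J. (c i)\<^sup>2) / 8)"
  using assms(1-4)
proof (induction J arbitrary: f rule: finite_induct)
  case empty
  then show ?case
    by (simp add: PiM_empty lebesgue_integral_count_space_finite)
next
  case (insert i J)
  note f[measurable] = insert.prems(1) and bnd = insert.prems(2) and diff = insert.prems(3)
  interpret J: finite_product_prob_space M J
    by unfold_locales (rule insert.hyps)
  interpret iJ: finite_product_prob_space M "insert i J"
    by unfold_locales (use insert.hyps in simp)
  have upd: "x(i := y) \<in> space (Pi\<^sub>M (insert i J) M)"
    if "x \<in> space (Pi\<^sub>M J M)" "y \<in> space (M i)" for x y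
    using that by (simp add: space_PiM PiE_fun_upd)
  have meas2: "(\<lambda>(x, y). f (x(i := y))) \<in> borel_measurable (Pi\<^sub>M J M \<Otimes>\<^sub>M M i)"
    using measurable_compose[OF measurable_add_dim f] by (simp add: case_prod_beta')
  have meas[measurable]: "(\<lambda>y. f (x(i := y))) \<in> borel_measurable (M i)"
    if "x \<in> space (Pi\<^sub>M J M)" for x
    using measurable_compose[OF measurable_Pair1'[OF that] meas2] by simp
  define g where "g x = (\<integral>y. f (x(i := y)) \<partial>M i)" for x
  have g[measurable]: "g \<in> borel_measurable (Pi\<^sub>M J M)"
    unfolding g_def by (rule M.borel_measurable_lebesgue_integral[OF meas2])
  have int: "integrable (M i) (\<lambda>y. f (x(i := y)))" if "x \<in> space (Pi\<^sub>M J M)" for x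
    by (rule M.integrable_const_bound[where B = B]) (use that bnd upd in auto)
  have bnd_g: "\<bar>g x\<bar> \<le> B" if "x \<in> space (Pi\<^sub>M J M)" for x
    unfolding g_def by (rule M.abs_expectation_le_const[OF int[OF that] bnd[OF upd[OF that]]])
  have diff_g: "\<bar>g x - g (x(j := z))\<bar> \<le> c j"
    if "x \<in> space (Pi\<^sub>M J M)" "j \<in> J" "z \<in> space (M j)" for x j z
  proof -
    \<comment> \<open>Updates at distinct coordinates commute, so the difference bound of
      \<open>f\<close> at \<open>j\<close> can be used under the integral over coordinate
      \<open>i\<close>.\<close>
    have "i \<noteq> j"
      using that insert.hyps by auto
    have x': "x(j := z) \<in> space (Pi\<^sub>M J M)"
      using that by (auto simp: space_PiM PiE_def extensional_def)
    have eq: "g x - g (x(j := z)) = (\<integral>y. f (x(i := y)) - f ((x(j := z))(i := y)) \<partial>M i)"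
      unfolding g_def by (rule Bochner_Integration.integral_diff[symmetric]) (intro int that x')+
    have ptw: "\<bar>f (x(i := y)) - f ((x(j := z))(i := y))\<bar> \<le> c j" if "y \<in> space (M i)" for y
      using diff[OF upd[OF \<open>x \<in> space (Pi\<^sub>M J M)\<close> that], of j z] \<open>j \<in> J\<close> \<open>z \<in> _\<close>
      unfolding fun_upd_twist[OF \<open>i \<noteq> j\<close>[symmetric], of x z y] by blast
    have int': "integrable (M i) (\<lambda>y. f (x(i := y)) - f ((x(j := z))(i := y)))"
      by (intro Bochner_Integration.integrable_diff int that x')
    show ?thesis
      unfolding eq by (rule M.abs_expectation_le_const[OF int' ptw])
  qed
  have exp_bound: "norm (exp (l * h)) \<le> exp (l * B)" if "\<bar>h\<bar> \<le> B" for h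
    using that \<open>l > 0\<close> by simp
  have int_f: "integrable (Pi\<^sub>M (insert i J) M) f"
    by (rule iJ.integrable_const_bound[where B = B]) (use bnd in auto)
  have int_exp: "integrable (Pi\<^sub>M (insert i J) M) (\<lambda>x. exp (l * f x))"
    by (rule iJ.integrable_const_bound[where B = "exp (l * B)"]) (use bnd exp_bound in auto)
  have int_exp_g: "integrable (Pi\<^sub>M J M) (\<lambda>x. exp (l * g x))"
    by (rule J.integrable_const_bound[where B = "exp (l * B)"]) (use bnd_g exp_bound in auto)
  have "(\<integral>x. exp (l * f x) \<partial>Pi\<^sub>M (insert i J) M)
      = (\<integral>x. (\<integral>y. exp (l * f (x(i := y))) \<partial>M i) \<partial>Pi\<^sub>M J M)"
    by (rule product_integral_insert) (use insert.hyps int_exp in auto)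
  also have "\<dots> \<le> (\<integral>x. exp (l\<^sup>2 * (c i)\<^sup>2 / 8) * exp (l * g x) \<partial>Pi\<^sub>M J M)"
  proof (rule integral_mono')
    fix x assume x: "x \<in> space (Pi\<^sub>M J M)"
    \<comment> \<open>The second point is the first one with its coordinate \<open>i\<close>
      overwritten once more.\<close>
    have "\<bar>f (x(i := y)) - f (x(i := z))\<bar> \<le> c i" if "y \<in> space (M i)" "z \<in> space (M i)" for y z
      using diff[OF upd[OF x that(1)] insertI1 that(2)] unfolding fun_upd_upd by blast
    then show "(\<integral>y. exp (l * f (x(i := y))) \<partial>M i) \<le> exp (l\<^sup>2 * (c i)\<^sup>2 / 8) * exp (l * g x)"
      using M.Hoeffdings_lemma_bochner[OF meas[OF x] _ \<open>l > 0\<close>, of "c i"]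
      by (simp add: g_def exp_add mult.commute)
  qed (use int_exp_g in auto)
  also have "\<dots> = exp (l\<^sup>2 * (c i)\<^sup>2 / 8) * (\<integral>x. exp (l * g x) \<partial>Pi\<^sub>M J M)"
    by simp
  also have "\<dots> \<le> exp (l\<^sup>2 * (c i)\<^sup>2 / 8) *
      exp (l * (\<integral>x. g x \<partial>Pi\<^sub>M J M) + l\<^sup>2 * (\<Sum>i\<in>J. (c i)\<^sup>2) / 8)"
    by (intro mult_left_mono insert.IH g bnd_g diff_g) auto
  also have "(\<integral>x. g x \<partial>Pi\<^sub>M J M) = (\<integral>x. f x \<partial>Pi\<^sub>M (insert i J) M)"
    unfolding g_def by (rule product_integral_insert[symmetric]) (use insert.hyps int_f in auto)
  finally show ?case
    using insert.hyps by (simp add: exp_add[symmetric] algebra_simps add_divide_distrib)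
qed

theorem (in product_prob_space) McDiarmid_ineq:
  fixes f :: "('i \<Rightarrow> 'a) \<Rightarrow> real"
  assumes "finite J" and f[measurable]: "f \<in> borel_measurable (Pi\<^sub>M J M)"
    and bnd: "\<And>x. x \<in> space (Pi\<^sub>M J M) \<Longrightarrow> \<bar>f x\<bar> \<le> B"
    and diff: "\<And>x i y. x \<in> space (Pi\<^sub>M J M) \<Longrightarrow> i \<in> J \<Longrightarrow> y \<in> space (M i) \<Longrightarrow>
           \<bar>f x - f (x(i := y))\<bar> \<le> c i"
    and pos: "(\<Sum>i\<in>J. (c i)\<^sup>2) > 0" and "t > 0"
  shows "measure (Pi\<^sub>M J M) {x \<in> space (Pi\<^sub>M J M). f x \<ge> (\<integral>x. f x \<partial>Pi\<^sub>M J M) + t}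
           \<le> exp (- 2 * t\<^sup>2 / (\<Sum>i\<in>J. (c i)\<^sup>2))"
proof -
  interpret J: finite_product_prob_space M J
    by unfold_locales (rule assms)
  define C where "C = (\<Sum>i\<in>J. (c i)\<^sup>2)"
  define E where "E = (\<integral>x. f x \<partial>Pi\<^sub>M J M)"
  \<comment> \<open>This is the minimiser of the Chernoff exponent
    \<open>- l * t + l\<^sup>2 * C / 8\<close>, whose minimum is
    \<open>- 2 * t\<^sup>2 / C\<close>.\<close>
  define l where "l = 4 * t / C"
  have "C > 0" "l > 0"
    using pos \<open>t > 0\<close> by (auto simp: C_def l_def)
  have int: "integrable (Pi\<^sub>M J M) (\<lambda>x. exp (l * f x))"
    by (rule J.integrable_const_bound[where B = "exp (l * B)"])
      (use bnd \<open>l > 0\<close> in \<open>auto simp: abs_le_iff\<close>)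
  have "measure (Pi\<^sub>M J M) {x \<in> space (Pi\<^sub>M J M). f x \<ge> E + t}
      \<le> exp (- l * (E + t)) * (\<integral>x\<in>space (Pi\<^sub>M J M). exp (l * f x) \<partial>Pi\<^sub>M J M)"
  proof (rule J.Chernoff_ineq_ge)
    have "set_integrable (Pi\<^sub>M J M) (space (Pi\<^sub>M J M)) (\<lambda>x. exp (l * f x))
        \<longleftrightarrow> integrable (Pi\<^sub>M J M) (\<lambda>x. exp (l * f x))"
      unfolding set_integrable_def by (rule Bochner_Integration.integrable_cong) auto
    then show "set_integrable (Pi\<^sub>M J M) (space (Pi\<^sub>M J M)) (\<lambda>x. exp (l * f x))"
      using int by simp
  qed (use \<open>l > 0\<close> in auto)
  also have "(\<integral>x\<in>space (Pi\<^sub>M J M). exp (l * f x) \<partial>Pi\<^sub>M J M) = (\<integral>x. exp (l * f x) \<partial>Pi\<^sub>M J M)"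
    by (simp add: set_integral_space int)
  also have "\<dots> \<le> exp (l * E + l\<^sup>2 * C / 8)"
    unfolding E_def C_def by (rule bounded_differences_exp_moment) (use assms \<open>l > 0\<close> in auto)
  also have "exp (- l * (E + t)) * exp (l * E + l\<^sup>2 * C / 8) = exp (- 2 * t\<^sup>2 / C)"
    using \<open>C > 0\<close> by (simp add: l_def exp_add[symmetric] field_simps power2_eq_square)
  finally show ?thesis
    by (simp add: E_def C_def)
qed

subsection \<open>Rate of decay of the bound\<close>

lemma has_sum_atLeast_Suc_0_iff:
  "(f has_sum S) {Suc 0..} \<longleftrightarrow> ((\<lambda>j. f (Suc j)) has_sum S) UNIV"
proof -
  have "{Suc 0..} = range Suc"
    by (simp add: atLeast_Suc_greaterThan greaterThan_0)
  then show ?thesis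
    by (simp add: has_sum_reindex o_def)
qed

lemma summable_on_atLeast_1_imp_summable:
  fixes f :: "nat \<Rightarrow> real"
  assumes "f summable_on {1..}"
  shows "summable (\<lambda>j. f (Suc j))"
  using has_sum_infsum[OF assms] by (auto simp: has_sum_atLeast_Suc_0_iff dest: has_sum_imp_sums sums_summable)

lemma infsum_atLeast_1_eq_suminf:
  fixes f :: "nat \<Rightarrow> real"
  assumes "f summable_on {1..}"
  shows "infsum f {1..} = (\<Sum>j. f (Suc j))"
  using has_sum_infsum[OF assms] by (auto simp: has_sum_atLeast_Suc_0_iff dest!: has_sum_imp_sums sums_unique)

lemma distributionD:
  assumes "distribution p"
  shows distribution_nonneg: "j \<ge> 1 \<Longrightarrow> 0 \<le> p j"
    and distribution_has_sum: "(p has_sum 1) {1..}"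
    and distribution_summable_on: "p summable_on {1..}"
  using assms by (auto simp: distribution_def summable_on_def)

text \<open>The summands of \<open>alpha\<close> and \<open>beta\<close> are merged into one
  function of \<open>j\<close>, so that a single series carries summability, domination and the
  limit. At \<open>n = 0\<close> division by zero makes every term with \<open>0 \<le> p j\<close>
  vanish.\<close>

definition l1_bound_term :: "nat \<Rightarrow> (nat \<Rightarrow> real) \<Rightarrow> nat \<Rightarrow> real" where
  "l1_bound_term n p j = (if p j < 1 / real n then 2 * p j else 1 / sqrt (real n) * sqrt (p j))"

text \<open>The premise gives 1 / sqrt n \<le> sqrt x, and sqrt x times sqrt x is x. Thus the terms
  of \<open>beta\<close> are dominated by \<open>p\<close>. For \<open>n = 0\<close> the premise
  reads \<open>0 \<le> x\<close> and the left side is 0.\<close>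

lemma sqrt_mult_le_if_ge_inverse:
  fixes x :: real
  assumes "1 / real n \<le> x"
  shows "1 / sqrt (real n) * sqrt x \<le> x"
proof -
  have "0 \<le> x"
    using assms by (rule order_trans[rotated]) simp
  have "1 / sqrt (real n) = sqrt (1 / real n)"
    by (simp add: real_sqrt_divide)
  also have "\<dots> \<le> sqrt x"
    using assms by (rule real_sqrt_le_mono)
  finally have "1 / sqrt (real n) * sqrt x \<le> sqrt x * sqrt x"
    using \<open>0 \<le> x\<close> by (intro mult_right_mono) auto
  then show ?thesis
    using \<open>0 \<le> x\<close> by simp
qed

lemma l1_bound_term_nonneg: "0 \<le> p j \<Longrightarrow> 0 \<le> l1_bound_term n p j"
  by (simp add: l1_bound_term_def)

lemma l1_bound_term_le: "0 \<le> p j \<Longrightarrow> l1_bound_term n p j \<le> 2 * p j"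
  using sqrt_mult_le_if_ge_inverse[of n "p j"] by (auto simp: l1_bound_term_def)

lemma l1_bound_term_summable_on:
  assumes "distribution p"
  shows "l1_bound_term n p summable_on {1..}"
  by (rule summable_on_comparison_test[OF summable_on_cmult_right[OF distribution_summable_on[OF assms], of 2]])
     (use distribution_nonneg[OF assms] in \<open>auto intro: l1_bound_term_le l1_bound_term_nonneg\<close>)

text \<open>The index sets of \<open>alpha\<close> and \<open>beta\<close> partition
  \<open>{1..}\<close>. Extension by zero puts both sums on this set, and comparison with the merged
  terms gives the summability that allows adding them.\<close>

lemma alpha_plus_beta_eq_infsum:
  assumes "distribution p"
  shows "alpha n p + beta n p = infsum (l1_bound_term n p) {1..}"
proof -
  note nonneg = distribution_nonneg[OF assms]
  define A where "A j = (if p j < 1 / real n then 2 * p j else 0)" for j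
  define B where "B j = (if p j < 1 / real n then 0 else 1 / sqrt (real n) * sqrt (p j))" for j
  have "alpha n p = infsum A {1..}"
    unfolding alpha_def infsum_cmult_right'[symmetric] A_def by (rule infsum_cong_neutral) auto
  moreover have "beta n p = infsum B {1..}"
    unfolding beta_def infsum_cmult_right'[symmetric] B_def by (rule infsum_cong_neutral) auto
  moreover have "A summable_on {1..}" "B summable_on {1..}"
    by (rule summable_on_comparison_test[OF l1_bound_term_summable_on[OF assms, of n]],
        use nonneg in \<open>force simp: A_def B_def l1_bound_term_def\<close>,
        use nonneg in \<open>force simp: A_def B_def\<close>)+
  ultimately have "alpha n p + beta n p = infsum (\<lambda>j. A j + B j) {1..}"
    by (simp add: infsum_add)
  also have "(\<lambda>j. A j + B j) = l1_bound_term n p"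
    by (auto simp: A_def B_def l1_bound_term_def)
  finally show ?thesis .
qed

text \<open>If \<open>p j\<close> is positive, then 1 / n eventually drops below it, and from then
  on the term is a constant divided by sqrt n.\<close>

lemma l1_bound_term_tendsto_0:
  assumes "0 \<le> p j"
  shows "(\<lambda>n. l1_bound_term n p j) \<longlonglongrightarrow> 0"
proof (cases "p j = 0")
  case True
  then have "l1_bound_term n p j = 0" for n
    by (simp add: l1_bound_term_def)
  then show ?thesis
    by simp
next
  case False
  have "(\<lambda>n. 1 / real n) \<longlonglongrightarrow> 0"
    by real_asymp
  then have "\<forall>\<^sub>F n in sequentially. 1 / real n < p j"
    using False assms by (intro order_tendstoD(2)) auto
  then have "\<forall>\<^sub>F n in sequentially. 1 / sqrt (real n) * sqrt (p j) = l1_bound_term n p j"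
    by eventually_elim (auto simp: l1_bound_term_def)
  moreover have "(\<lambda>n. 1 / sqrt (real n) * sqrt (p j)) \<longlonglongrightarrow> 0"
    by real_asymp
  ultimately show ?thesis
    by (rule Lim_transform_eventually[rotated])
qed

lemma alpha_plus_beta_tendsto_0:
  assumes "distribution p"
  shows "(\<lambda>n. alpha n p + beta n p) \<longlonglongrightarrow> 0"
proof -
  note nonneg = distribution_nonneg[OF assms]
  have "(\<lambda>n. \<Sum>j. l1_bound_term n p (Suc j)) \<longlonglongrightarrow> (\<Sum>j. 0)"
  \<comment> \<open>Tannery's theorem is dominated convergence for series; the majorant
    \<open>2 * p\<close> is summable and independent of \<open>n\<close>.\<close>
  proof (rule tannerys_theorem[THEN conjunct2, THEN conjunct2])
    show "\<forall>\<^sub>F (j, n) in at_top \<times>\<^sub>F sequentially. norm (l1_bound_term n p (Suc j)) \<le> 2 * p (Suc j)"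
      using nonneg l1_bound_term_le l1_bound_term_nonneg by (intro always_eventually) auto
    show "summable (\<lambda>j. 2 * p (Suc j))"
      by (intro summable_mult summable_on_atLeast_1_imp_summable distribution_summable_on assms)
  qed (use nonneg in \<open>auto intro: l1_bound_term_tendsto_0\<close>)
  then show ?thesis
    unfolding alpha_plus_beta_eq_infsum[OF assms]
      infsum_atLeast_1_eq_suminf[OF l1_bound_term_summable_on[OF assms]] by simp
qed

section \<open>Distributions with slowly decaying tails\<close>

text \<open>Monotonicity makes the terms nonnegative, which turns the convergent telescoping series
  into an unconditional sum. At \<open>n = 0\<close> it gives the total mass, at general
  \<open>n\<close> the mass beyond \<open>n\<close>. As \<open>j > n\<close>, the subtraction
  \<open>j - 1\<close> never truncates.\<close>

lemma has_sum_telescope: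
  fixes T :: "nat \<Rightarrow> real"
  assumes "decseq T" and "T \<longlonglongrightarrow> 0"
  shows "((\<lambda>j. T (j - 1) - T j) has_sum T n) {n<..}"
proof -
  have "(\<lambda>k. T (n + k) - T (n + Suc k)) sums (T (n + 0) - 0)"
    using LIMSEQ_ignore_initial_segment[OF assms(2), of n]
    by (intro telescope_sums') (simp add: add.commute)
  then have "((\<lambda>k. T (n + k) - T (n + Suc k)) has_sum T n) UNIV"
    using assms(1) by (intro sums_nonneg_imp_has_sum) (auto simp: decseq_def)
  moreover have "{n<..} = range (\<lambda>k. n + Suc k)"
    by (auto simp: image_iff less_iff_Suc_add)
  moreover have "inj (\<lambda>k. n + Suc k)"
    by (auto simp: inj_def)
  ultimately show ?thesis
    by (simp add: has_sum_reindex o_def)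
qed

text \<open>The limit 0 is a lower bound of the next value, which lies strictly below
  \<open>r n\<close>.\<close>

lemma strict_antimono_tendsto_0_pos:
  fixes r :: "nat \<Rightarrow> real"
  assumes anti: "strict_antimono_on {1..} r" and lim: "r \<longlonglongrightarrow> 0" and "n \<ge> 1"
  shows "0 < r n"
proof -
  have "0 \<le> r (Suc n)"
  proof (rule LIMSEQ_le_const2[OF lim], intro exI allI impI)
    fix m assume "Suc n \<le> m"
    then show "r m \<le> r (Suc n)"
      using monotone_onD[OF anti, of "Suc n" m] by (cases "Suc n = m") auto
  qed
  also have "r (Suc n) < r n"
    using monotone_onD[OF anti, of n "Suc n"] assms(3) by simp
  finally show ?thesis .
qed

lemma slow_decay_tail:
  fixes r :: "nat \<Rightarrow> real"
  assumes "r 1 < 1" and anti: "strict_antimono_on {1..} r" and lim: "r \<longlonglongrightarrow> 0"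
  obtains T where "T 0 = 1" "decseq T" "T \<longlonglongrightarrow> 0"
    "\<And>n. n \<ge> 1 \<Longrightarrow> r n \<le> T n" "\<And>n. T n - T (Suc n) \<le> 1 / real (Suc n)"
proof -
  (* The term t - 1/k lets T fall as fast as the harmonic series diverges, whence T tends to 0. *)
  define T where "T = rec_nat 1 (\<lambda>k t. max (r (Suc k)) (t - 1 / real (Suc k)))"
  have T0: "T 0 = 1" and TSuc: "T (Suc k) = max (r (Suc k)) (T k - 1 / real (Suc k))" for k
    by (simp_all add: T_def)
  have ge: "r n \<le> T n" if "n \<ge> 1" for n
    using that by (cases n) (auto simp: TSuc)
  have anti': "r (Suc n) \<le> r n" if "n \<ge> 1" for n
    using monotone_onD[OF anti, of n "Suc n"] that by auto
  have "r (Suc n) \<le> T n" for n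
  proof (cases "n = 0")
    case False
    then show ?thesis
      using ge[of n] anti'[of n] by simp
  qed (use assms T0 in simp)
  then have dec: "decseq T"
    by (intro decseq_SucI) (auto simp: TSuc)
  have T_nonneg: "T n \<ge> 0" for n
  proof (cases "n = 0")
    case False
    then show ?thesis
      using ge[of n] strict_antimono_tendsto_0_pos[OF anti lim, of n] by simp
  qed (simp add: T0)
  obtain L where L: "T \<longlonglongrightarrow> L" "\<And>i. L \<le> T i"
    using decseq_convergent[OF dec] T_nonneg by blast
  have "L = 0"
  proof (rule ccontr)
    assume "L \<noteq> 0"
    moreover have "L \<ge> 0"
      using LIMSEQ_le_const[OF L(1)] T_nonneg by blast
    ultimately have "\<forall>\<^sub>F n in sequentially. r n < L"
      using lim by (intro order_tendstoD(2)) auto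
    then obtain N where N: "\<And>n. n \<ge> N \<Longrightarrow> r n < L"
      by (auto simp: eventually_sequentially)
    \<comment> \<open>Here \<open>r (Suc n) < L \<le> T (Suc n)\<close>, so the maximum is not
      attained by \<open>r (Suc n)\<close>.\<close>
    have step: "T (Suc n) = T n - 1 / real (Suc n)" if "n \<ge> N" for n
      using N[of "Suc n"] L(2)[of "Suc n"] that by (auto simp: TSuc)
    \<comment> \<open>From \<open>N\<close> on, \<open>T\<close> loses exactly what the harmonic
      numbers gain; as these are unbounded, \<open>T\<close> would become negative.\<close>
    have "T (N + k) + harm (N + k) = T N + harm N" for k
      by (induction k) (auto simp: step harm_Suc inverse_eq_divide)
    moreover have "\<forall>\<^sub>F m in sequentially. T N + harm N < harm m"
      using harm_at_top by (simp add: filterlim_at_top_dense)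
    then obtain m where "T N + harm N < harm m" "N \<le> m"
      using eventually_happens[OF eventually_conj[OF _ eventually_ge_at_top[of N]]] by auto
    ultimately show False
      using T_nonneg[of m] by (metis le_Suc_ex le_add_same_cancel2 linorder_not_less)
  qed
  moreover have "T n - T (Suc n) \<le> 1 / real (Suc n)" for n
    by (simp add: TSuc)
  ultimately show thesis
    using that[OF T0 dec] L ge by blast
qed

lemma ex_distribution_alpha_beta_gt:
  fixes r :: "nat \<Rightarrow> real"
  assumes "r 1 < 1" and anti: "strict_antimono_on {1..} r" and "r \<longlonglongrightarrow> 0"
  shows "\<exists>p. distribution p \<and> (\<forall>n\<ge>1. alpha n p + beta n p > r n)"
proof -
  obtain T where T: "T 0 = 1" "decseq T" "T \<longlonglongrightarrow> 0"
    and ge: "\<And>n. n \<ge> 1 \<Longrightarrow> r n \<le> T n" and step: "\<And>n. T n - T (Suc n) \<le> 1 / real (Suc n)"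
    using slow_decay_tail[OF assms] by blast
  define p where "p j = T (j - 1) - T j" for j
  note tail = has_sum_telescope[OF T(2,3), folded p_def]
  have "{0<..} = {1::nat..}"
    by auto
  have p_nonneg: "0 \<le> p j" for j
    using T(2) by (auto simp: p_def decseq_def)
  have distr: "distribution p"
    using tail[of 0] p_nonneg T(1) \<open>{0<..} = {1..}\<close> by (simp add: distribution_def)
  have p_le: "p j \<le> 1 / real j" if "j \<ge> 1" for j
    using step[of "j - 1"] that by (simp add: p_def)
  have "alpha n p + beta n p > r n" if "n \<ge> 1" for n
  proof -
    have small: "p j < 1 / real n" if "n < j" for j
    proof -
      have "p j \<le> 1 / real j"
        using that by (intro p_le) simp
      also have "\<dots> < 1 / real n"
        using that \<open>n \<ge> 1\<close> by (intro divide_strict_left_mono) auto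
      finally show ?thesis .
    qed
    have "T n = infsum p {n<..}"
      by (rule infsumI[OF tail, symmetric])
    also have "\<dots> \<le> infsum p {j \<in> {1..}. p j < 1 / real n}"
    proof (rule infsum_mono_neutral)
      show "p summable_on {n<..}"
        using tail by (auto simp: summable_on_def)
      show "p summable_on {j \<in> {1..}. p j < 1 / real n}"
        by (rule summable_on_subset_banach[OF distribution_summable_on[OF distr]]) auto
    qed (use small p_nonneg \<open>n \<ge> 1\<close> in auto)
    finally have "2 * T n \<le> alpha n p"
      by (simp add: alpha_def)
    moreover have "0 \<le> beta n p"
      unfolding beta_def by (intro mult_nonneg_nonneg infsum_nonneg) (auto simp: p_nonneg)
    \<comment> \<open>Positivity and the factor 2 in \<open>alpha\<close> give strictness:
      \<open>2 * T n \<ge> 2 * r n > r n\<close>.\<close>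
    moreover have "0 < r n"
      by (rule strict_antimono_tendsto_0_pos[OF anti assms(3) that])
    ultimately show ?thesis
      using ge[OF that] by linarith
  qed
  with distr show ?thesis by blast
qed

subsection \<open>Concentration of the \<open>\<ell>\<^sub>1\<close> distance\<close>

lemma has_sum_of_bool_eq:
  assumes "a \<in> A"
  shows "((\<lambda>j. of_bool (a = j) :: real) has_sum 1) A"
proof -
  have "((\<lambda>j. of_bool (a = j) :: real) has_sum 1) {a}"
    using has_sum_finite[of "{a}" "\<lambda>j. of_bool (a = j) :: real"] by simp
  then show ?thesis
    by (rule has_sum_cong_neutral[THEN iffD1, rotated -1]) (use assms in auto)
qed

lemma has_sum_sum:
  fixes f :: "'b \<Rightarrow> 'a \<Rightarrow> 'c :: topological_comm_monoid_add"
  assumes "finite I" and "\<And>i. i \<in> I \<Longrightarrow> (f i has_sum s i) A"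
  shows "((\<lambda>x. \<Sum>i\<in>I. f i x) has_sum (\<Sum>i\<in>I. s i)) A"
  using assms by (induction I rule: finite_induct) (auto intro!: has_sum_add)

lemma emp_freq_nonneg: "0 \<le> emp_freq X n j \<omega>"
  by (simp add: emp_freq_def sum_nonneg)

lemma emp_freq_has_sum:
  assumes "n \<ge> 1" and "\<And>i. i \<in> {1..n} \<Longrightarrow> X i \<omega> \<ge> 1"
  shows "((\<lambda>j. emp_freq X n j \<omega>) has_sum 1) {1..}"
proof -
  have "((\<lambda>j. \<Sum>i=1..n. of_bool (X i \<omega> = j) :: real) has_sum (\<Sum>i=1..n. 1)) {1..}"
    using assms(2) by (intro has_sum_sum has_sum_of_bool_eq) auto
  then have "((\<lambda>j. 1 / real n * (\<Sum>i=1..n. of_bool (X i \<omega> = j))) has_sum (1 / real n * (\<Sum>i=1..n. 1))) {1..}"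
    by (rule has_sum_cmult_right)
  then show ?thesis
    using assms(1) by (simp add: emp_freq_def)
qed

section \<open>Boundedness and bounded differences of the distance\<close>

context
  fixes p :: "nat \<Rightarrow> real" and n :: nat
  assumes p: "distribution p" and n: "n \<ge> 1"
begin

text \<open>By the triangle inequality the terms are dominated by the sum of two nonnegative
  sequences of mass 1. The condition on the sample ensures that no observation falls outside the
  range of summation.\<close>

lemma l1_dist_summable_on:
  assumes "\<And>i. i \<in> {1..n} \<Longrightarrow> X i \<omega> \<ge> 1"
  shows "(\<lambda>j. \<bar>emp_freq X n j \<omega> - p j\<bar>) summable_on {1..}"
    and l1_dist_le_2: "l1_dist p X n \<omega> \<le> 2"
proof -
  have sums: "((\<lambda>j. emp_freq X n j \<omega> + p j) has_sum (1 + 1)) {1..}"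
    by (intro has_sum_add emp_freq_has_sum distribution_has_sum p n assms)
  have le: "\<bar>emp_freq X n j \<omega> - p j\<bar> \<le> emp_freq X n j \<omega> + p j" if "j \<in> {1..}" for j
    using distribution_nonneg[OF p, of j] emp_freq_nonneg[of X n j \<omega>] that by auto
  show summable: "(\<lambda>j. \<bar>emp_freq X n j \<omega> - p j\<bar>) summable_on {1..}"
    by (rule summable_on_comparison_test[OF has_sum_imp_summable[OF sums] le]) auto
  have "l1_dist p X n \<omega> \<le> infsum (\<lambda>j. emp_freq X n j \<omega> + p j) {1..}"
    unfolding l1_dist_def by (intro infsum_mono summable has_sum_imp_summable[OF sums] le)
  then show "l1_dist p X n \<omega> \<le> 2"
    using infsumI[OF sums] by simp
qed

text \<open>Only the frequencies of the old and the new value can change, each by at most 1 / n;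
  \<open>d\<close> records this. The argument \<open>\<lambda>i x. x i\<close> is the sample of
  coordinate maps, which makes the distance a function on the product space.\<close>

lemma l1_dist_fun_upd_le:
  assumes x: "\<And>i. i \<in> {1..n} \<Longrightarrow> x i \<ge> 1" and k: "k \<in> {1..n}" and "y \<ge> 1"
  shows "l1_dist p (\<lambda>i x. x i) n x \<le> l1_dist p (\<lambda>i x. x i) n (x(k := y)) + 2 / real n"
proof -
  define e where "e j z = emp_freq (\<lambda>i x. x i) n j z" for j and z :: "nat \<Rightarrow> nat"
  define d where "d j = 1 / real n * (of_bool (x k = j) + of_bool (y = j))" for j
  have "(d has_sum (1 / real n * (1 + 1))) {1..}"
    unfolding d_def using x[OF k] \<open>y \<ge> 1\<close>
    by (intro has_sum_cmult_right has_sum_add has_sum_of_bool_eq) auto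
  then have d: "d summable_on {1..}" "infsum d {1..} = 2 / real n"
    by (auto simp: summable_on_def infsumI)
  have upd: "1 \<le> (x(k := y)) i" if "i \<in> {1..n}" for i
    using x[OF that] \<open>y \<ge> 1\<close> by simp
  have change: "\<bar>e j x - e j (x(k := y))\<bar> \<le> d j" for j
  proof -
    have "(\<Sum>i=1..n. of_bool (x i = j)) = of_bool (x k = j) + (\<Sum>i\<in>{1..n} - {k}. of_bool (x i = j) :: real)"
      using k by (intro sum.remove) auto
    moreover have "(\<Sum>i=1..n. of_bool ((x(k := y)) i = j))
        = of_bool (y = j) + (\<Sum>i\<in>{1..n} - {k}. of_bool (x i = j) :: real)"
      using k by (subst sum.remove[where x = k]) (auto intro!: sum.cong)
    ultimately have "e j x - e j (x(k := y)) = 1 / real n * (of_bool (x k = j) - of_bool (y = j))"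
      by (simp add: e_def emp_freq_def algebra_simps)
    then show ?thesis
      by (auto simp: d_def)
  qed
  have summable: "(\<lambda>j. \<bar>e j x - p j\<bar>) summable_on {1..}"
    "(\<lambda>j. \<bar>e j (x(k := y)) - p j\<bar>) summable_on {1..}"
    unfolding e_def by (rule l1_dist_summable_on, fact x upd)+
  have "l1_dist p (\<lambda>i x. x i) n x \<le> (\<Sum>\<^sub>\<infinity>j\<in>{1..}. \<bar>e j (x(k := y)) - p j\<bar> + d j)"
    unfolding l1_dist_def e_def[symmetric]
  proof (rule infsum_mono)
    show "\<bar>e j x - p j\<bar> \<le> \<bar>e j (x(k := y)) - p j\<bar> + d j" for j
      using change[of j] by linarith
  qed (intro summable summable_on_add d)+
  also have "\<dots> = l1_dist p (\<lambda>i x. x i) n (x(k := y)) + 2 / real n"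
    unfolding l1_dist_def e_def[symmetric] infsum_add[OF summable(2) d(1)] d(2) ..
  finally show ?thesis .
qed

lemma l1_dist_bounded_difference:
  assumes x: "\<And>i. i \<in> {1..n} \<Longrightarrow> x i \<ge> 1" and k: "k \<in> {1..n}" and "y \<ge> 1"
  shows "\<bar>l1_dist p (\<lambda>i x. x i) n x - l1_dist p (\<lambda>i x. x i) n (x(k := y))\<bar> \<le> 2 / real n"
proof -
  have "l1_dist p (\<lambda>i x. x i) n x \<le> l1_dist p (\<lambda>i x. x i) n (x(k := y)) + 2 / real n"
    by (rule l1_dist_fun_upd_le[OF assms])
  moreover have "l1_dist p (\<lambda>i x. x i) n (x(k := y)) \<le> l1_dist p (\<lambda>i x. x i) n x + 2 / real n"
    \<comment> \<open>Writing back the old value \<open>x k\<close> undoes the update, so the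
      one-sided bound also holds in the other direction.\<close>
    using l1_dist_fun_upd_le[of "x(k := y)" k "x k"] assms by auto
  ultimately show ?thesis by linarith
qed

end

section \<open>Moments of the empirical frequencies\<close>

locale iid_sample_space = prob_space M for M :: "'a measure" +
  fixes p :: "nat \<Rightarrow> real" and n :: nat and X :: "nat \<Rightarrow> 'a \<Rightarrow> nat"
  assumes p: "distribution p" and n: "n \<ge> 1" and iid: "iid_sample M p n X"
begin

lemma indep_X: "indep_vars (\<lambda>_. count_space {1..}) X {1..n}"
  using iid by (simp add: iid_sample_def)

lemma distributed_X: "i \<in> {1..n} \<Longrightarrow> distributed M (count_space {1..}) (X i) (\<lambda>j. ennreal (p j))"
  using iid by (simp add: iid_sample_def)

lemma measurable_X: "i \<in> {1..n} \<Longrightarrow> X i \<in> measurable M (count_space {1..})"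
  by (rule distributed_measurable[OF distributed_X])

lemma X_ge_1: "i \<in> {1..n} \<Longrightarrow> \<omega> \<in> space M \<Longrightarrow> X i \<omega> \<ge> 1"
  using measurable_space[OF measurable_X] by fastforce

lemma measurable_of_bool_X: "i \<in> {1..n} \<Longrightarrow> (\<lambda>\<omega>. of_bool (X i \<omega> = j) :: real) \<in> borel_measurable M"
  using measurable_compose[OF measurable_X, of i "\<lambda>x. of_bool (x = j)" borel] by simp

lemma integrable_of_bool_X: "i \<in> {1..n} \<Longrightarrow> integrable M (\<lambda>\<omega>. of_bool (X i \<omega> = j) :: real)"
  by (rule integrable_const_bound[where B = 1]) (auto intro: measurable_of_bool_X)

lemma expectation_of_bool_X:
  assumes i: "i \<in> {1..n}" and j: "j \<ge> 1"
  shows "expectation (\<lambda>\<omega>. of_bool (X i \<omega> = j)) = p j"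
proof -
  have "emeasure M (X i -` {j} \<inter> space M) = emeasure (distr M (count_space {1..}) (X i)) {j}"
    using measurable_X[OF i] j by (subst emeasure_distr) auto
  also have "\<dots> = emeasure (density (count_space {1..}) (\<lambda>j. ennreal (p j))) {j}"
    unfolding distributed_distr_eq_density[OF distributed_X[OF i]] ..
  also have "\<dots> = ennreal (p j)"
    using j by (simp add: emeasure_density)
  finally have "prob (X i -` {j} \<inter> space M) = p j"
    using distribution_nonneg[OF p j] by (simp add: measure_def)
  moreover have "expectation (\<lambda>\<omega>. of_bool (X i \<omega> = j)) = expectation (indicator (X i -` {j} \<inter> space M))"
    by (rule Bochner_Integration.integral_cong) (auto simp: indicator_def)
  moreover have "\<dots> = prob (X i -` {j} \<inter> space M)"
    by (subst Bochner_Integration.integral_indicator) (simp add: Int_assoc)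
  ultimately show ?thesis
    by metis
qed

lemma integrable_emp_freq: "integrable M (emp_freq X n j)"
  unfolding emp_freq_def[abs_def] by (intro integrable_mult_right Bochner_Integration.integrable_sum integrable_of_bool_X)

lemma expectation_emp_freq:
  assumes "j \<ge> 1"
  shows "expectation (emp_freq X n j) = p j"
proof -
  have "expectation (emp_freq X n j) = 1 / real n * (\<Sum>i=1..n. expectation (\<lambda>\<omega>. of_bool (X i \<omega> = j)))"
    unfolding emp_freq_def[abs_def] integral_mult_right_zero
    by (subst Bochner_Integration.integral_sum) (rule integrable_of_bool_X, auto)
  also have "\<dots> = 1 / real n * (\<Sum>i=1..n. p j)"
    using assms by (simp add: expectation_of_bool_X)
  finally show ?thesis
    using n by simp
qed

text \<open>Independence factors the expectation, and each factor is centred. Since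
  \<open>i \<noteq> k\<close>, the product over \<open>{i, k}\<close> really has two
  factors.\<close>

lemma expectation_covariance:
  assumes i: "i \<in> {1..n}" and k: "k \<in> {1..n}" and "i \<noteq> k" and j: "j \<ge> 1"
  shows "expectation (\<lambda>\<omega>. (of_bool (X i \<omega> = j) - p j) * (of_bool (X k \<omega> = j) - p j)) = 0"
proof -
  define Y where "Y i \<omega> = of_bool (X i \<omega> = j) - p j" for i \<omega>
  have indep: "indep_vars (\<lambda>_. borel) Y {i, k}"
    unfolding Y_def
    by (rule indep_vars_compose2[OF indep_vars_subset[OF indep_X]]) (use i k in auto)
  have int: "integrable M (Y l)" if "l \<in> {i, k}" for l
    using that i k unfolding Y_def by (auto intro!: Bochner_Integration.integrable_diff integrable_of_bool_X)
  have "expectation (\<lambda>\<omega>. \<Prod>l\<in>{i, k}. Y l \<omega>) = (\<Prod>l\<in>{i, k}. expectation (Y l))"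
    by (rule indep_vars_lebesgue_integral[OF _ indep int]) auto
  also have "expectation (Y i) = 0"
    unfolding Y_def using i j
    by (simp add: Bochner_Integration.integral_diff integrable_of_bool_X expectation_of_bool_X prob_space)
  then have "(\<Prod>l\<in>{i, k}. expectation (Y l)) = 0"
    by simp
  finally show ?thesis
    using \<open>i \<noteq> k\<close> by (simp add: Y_def)
qed

lemma expectation_variance_le:
  assumes i: "i \<in> {1..n}" and j: "j \<ge> 1"
  shows "expectation (\<lambda>\<omega>. (of_bool (X i \<omega> = j) - p j)\<^sup>2) \<le> p j"
proof -
  \<comment> \<open>An indicator equals its square, so the squared deviation is affine in the
    indicator and the Bernoulli variance can be read off.\<close>
  have "(\<lambda>\<omega>. (of_bool (X i \<omega> = j) - p j)\<^sup>2) = (\<lambda>\<omega>. (1 - 2 * p j) * of_bool (X i \<omega> = j) + (p j)\<^sup>2)"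
    by (auto simp: power2_eq_square algebra_simps)
  then have "expectation (\<lambda>\<omega>. (of_bool (X i \<omega> = j) - p j)\<^sup>2) = p j - (p j)\<^sup>2"
    using assms
    by (simp add: integrable_of_bool_X expectation_of_bool_X prob_space power2_eq_square algebra_simps)
  then show ?thesis
    by simp
qed

text \<open>Expanding the square gives a double sum of covariances: the off-diagonal ones vanish,
  and the \<open>n\<close> diagonal ones contribute at most \<open>p j\<close> each, against the
  factor 1 / n^2.\<close>

lemma expectation_square_emp_freq_diff_le:
  assumes j: "j \<ge> 1"
  shows "expectation (\<lambda>\<omega>. (emp_freq X n j \<omega> - p j)\<^sup>2) \<le> p j / real n"
proof -
  define Y where "Y i \<omega> = of_bool (X i \<omega> = j) - p j" for i \<omega>
  have meas: "Y i \<in> borel_measurable M" if "i \<in> {1..n}" for i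
    unfolding Y_def using measurable_of_bool_X[OF that] by simp
  have bnd: "\<bar>Y i \<omega>\<bar> \<le> 1 + \<bar>p j\<bar>" for i \<omega>
    by (auto simp: Y_def of_bool_def)
  have int: "integrable M (\<lambda>\<omega>. Y i \<omega> * Y k \<omega>)" if "i \<in> {1..n}" "k \<in> {1..n}" for i k
  proof (rule integrable_const_bound)
    show "AE \<omega> in M. norm (Y i \<omega> * Y k \<omega>) \<le> (1 + \<bar>p j\<bar>) * (1 + \<bar>p j\<bar>)"
      by (intro AE_I2) (auto simp: abs_mult intro!: mult_mono bnd)
  qed (use that meas in auto)
  have cov: "expectation (\<lambda>\<omega>. Y i \<omega> * Y k \<omega>) \<le> (if i = k then p j else 0)"
    if "i \<in> {1..n}" "k \<in> {1..n}" for i k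
    using expectation_covariance[OF that _ j] expectation_variance_le[OF that(1) j]
    by (auto simp: Y_def power2_eq_square)
  have "(emp_freq X n j \<omega> - p j)\<^sup>2 = 1 / (real n)\<^sup>2 * (\<Sum>i=1..n. \<Sum>k=1..n. Y i \<omega> * Y k \<omega>)" for \<omega>
  proof -
    have "emp_freq X n j \<omega> - p j = 1 / real n * (\<Sum>i=1..n. Y i \<omega>)"
      using n by (simp add: emp_freq_def Y_def sum_subtractf field_simps)
    then show ?thesis
      by (simp add: power2_eq_square sum_product)
  qed
  then have "expectation (\<lambda>\<omega>. (emp_freq X n j \<omega> - p j)\<^sup>2)
      = 1 / (real n)\<^sup>2 * expectation (\<lambda>\<omega>. \<Sum>i=1..n. \<Sum>k=1..n. Y i \<omega> * Y k \<omega>)"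
    by simp
  also have "expectation (\<lambda>\<omega>. \<Sum>i=1..n. \<Sum>k=1..n. Y i \<omega> * Y k \<omega>)
      = (\<Sum>i=1..n. expectation (\<lambda>\<omega>. \<Sum>k=1..n. Y i \<omega> * Y k \<omega>))"
    by (intro Bochner_Integration.integral_sum Bochner_Integration.integrable_sum int)
  also have "\<dots> = (\<Sum>i=1..n. \<Sum>k=1..n. expectation (\<lambda>\<omega>. Y i \<omega> * Y k \<omega>))"
    by (intro sum.cong refl Bochner_Integration.integral_sum int)
  also have "1 / (real n)\<^sup>2 * (\<Sum>i=1..n. \<Sum>k=1..n. expectation (\<lambda>\<omega>. Y i \<omega> * Y k \<omega>))
      \<le> 1 / (real n)\<^sup>2 * (\<Sum>i=1..n. \<Sum>k=1..n. if i = k then p j else 0)"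
    by (intro mult_left_mono sum_mono cov) auto
  also have "\<dots> = p j / real n"
    using n by (simp add: power2_eq_square)
  finally show ?thesis .
qed

text \<open>The estimates \<open>2 * p j\<close> and sqrt (p j / n) both hold for every
  \<open>j\<close>; \<open>l1_bound_term\<close> merely selects one of them.\<close>

lemma expectation_abs_emp_freq_diff_le:
  assumes j: "j \<ge> 1"
  shows "expectation (\<lambda>\<omega>. \<bar>emp_freq X n j \<omega> - p j\<bar>) \<le> l1_bound_term n p j"
proof -
  define D where "D \<omega> = \<bar>emp_freq X n j \<omega> - p j\<bar>" for \<omega>
  have pj: "0 \<le> p j"
    by (rule distribution_nonneg[OF p j])
  have int: "integrable M D"
    unfolding D_def by (intro integrable_abs Bochner_Integration.integrable_diff integrable_emp_freq) simp
  have "expectation D \<le> expectation (\<lambda>\<omega>. emp_freq X n j \<omega> + p j)"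
    using pj emp_freq_nonneg[of X n j]
    by (intro integral_mono int Bochner_Integration.integrable_add integrable_emp_freq)
      (auto simp: D_def abs_le_iff add_increasing add_increasing2)
  also have "\<dots> = 2 * p j"
    using j by (simp add: integrable_emp_freq expectation_emp_freq prob_space)
  finally have le1: "expectation D \<le> 2 * p j" .
  have D_nonneg: "0 \<le> D \<omega>" for \<omega>
    by (simp add: D_def)
  have D_le: "D \<omega> \<le> 1 + p j" for \<omega>
  proof -
    have "(\<Sum>i=1..n. of_bool (X i \<omega> = j) :: real) \<le> (\<Sum>i=1..n. 1)"
      by (rule sum_mono) auto
    then have "emp_freq X n j \<omega> \<le> 1"
      using n by (simp add: emp_freq_def field_simps)
    then show ?thesis
      using pj emp_freq_nonneg[of X n j \<omega>] by (auto simp: D_def)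
  qed
  have int2: "integrable M (\<lambda>\<omega>. (D \<omega>)\<^sup>2)"
  proof (rule integrable_const_bound)
    show "AE \<omega> in M. norm ((D \<omega>)\<^sup>2) \<le> (1 + p j)\<^sup>2"
      by (intro AE_I2) (simp add: power_mono D_le D_nonneg)
  qed (use int in auto)
  \<comment> \<open>This is nonnegativity of the variance of \<open>D\<close>.\<close>
  have "(expectation D)\<^sup>2 \<le> expectation (\<lambda>\<omega>. (D \<omega>)\<^sup>2)"
    using variance_positive[of D] variance_eq[OF int int2] by simp
  also have "\<dots> \<le> p j / real n"
    using expectation_square_emp_freq_diff_le[OF j] by (simp add: D_def)
  finally have "expectation D \<le> sqrt (p j / real n)"
    by (rule real_le_rsqrt)
  with le1 have "expectation D \<le> l1_bound_term n p j"
    by (simp add: l1_bound_term_def real_sqrt_divide)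
  then show ?thesis
    unfolding D_def .
qed

lemma
  shows measurable_l1_dist: "l1_dist p X n \<in> borel_measurable M"
    and expectation_l1_dist_le: "expectation (l1_dist p X n) \<le> alpha n p + beta n p"
proof -
  define D where "D j \<omega> = \<bar>emp_freq X n (Suc j) \<omega> - p (Suc j)\<bar>" for j \<omega>
  have int: "integrable M (D j)" for j
    unfolding D_def by (intro integrable_abs Bochner_Integration.integrable_diff integrable_emp_freq) simp
  \<comment> \<open>On \<open>space M\<close> all observations are at least 1, so the sum over
    \<open>{1..}\<close> converges there and agrees with a series of measurable functions.\<close>
  have summable_D: "summable (\<lambda>j. D j \<omega>)" and eq: "l1_dist p X n \<omega> = (\<Sum>j. D j \<omega>)" if "\<omega> \<in> space M" for \<omega>
  proof -
    have "(\<lambda>j. \<bar>emp_freq X n j \<omega> - p j\<bar>) summable_on {1..}"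
      by (rule l1_dist_summable_on[OF p n]) (rule X_ge_1[OF _ that])
    then show "summable (\<lambda>j. D j \<omega>)" "l1_dist p X n \<omega> = (\<Sum>j. D j \<omega>)"
      unfolding D_def l1_dist_def
      by (rule summable_on_atLeast_1_imp_summable, rule infsum_atLeast_1_eq_suminf)
  qed
  have ED: "expectation (D j) \<le> l1_bound_term n p (Suc j)" for j
    unfolding D_def by (rule expectation_abs_emp_freq_diff_le) simp
  have summable_bound: "summable (\<lambda>j. l1_bound_term n p (Suc j))"
    by (rule summable_on_atLeast_1_imp_summable[OF l1_bound_term_summable_on[OF p]])
  have abs_D: "\<bar>D j \<omega>\<bar> = D j \<omega>" for j \<omega>
    by (simp add: D_def)
  have nonneg: "0 \<le> expectation (D j)" for j
    by (rule Bochner_Integration.integral_nonneg) (simp add: D_def)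
  have summable_ED: "summable (\<lambda>j. expectation (D j))"
    by (rule summable_comparison_test[OF _ summable_bound]) (use ED nonneg in auto)
  have [measurable]: "D j \<in> borel_measurable M" for j
    using int by auto
  have "(\<lambda>\<omega>. \<Sum>j. D j \<omega>) \<in> borel_measurable M"
    by measurable
  then show "l1_dist p X n \<in> borel_measurable M"
    by (rule measurable_cong[THEN iffD1, rotated]) (simp add: eq)
  have "expectation (l1_dist p X n) = expectation (\<lambda>\<omega>. \<Sum>j. D j \<omega>)"
    by (rule Bochner_Integration.integral_cong) (simp_all add: eq)
  \<comment> \<open>Expectation and series may be exchanged because the terms are nonnegative and
    their expectations are summable.\<close>
  also have "\<dots> = (\<Sum>j. expectation (D j))"
    by (rule integral_suminf) (use int summable_D summable_ED in \<open>auto simp: abs_D\<close>)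
  also have "\<dots> \<le> (\<Sum>j. l1_bound_term n p (Suc j))"
    by (rule suminf_le[OF ED summable_ED summable_bound])
  also have "\<dots> = alpha n p + beta n p"
    using alpha_plus_beta_eq_infsum[OF p] infsum_atLeast_1_eq_suminf[OF l1_bound_term_summable_on[OF p]] by simp
  finally show "expectation (l1_dist p X n) \<le> alpha n p + beta n p" .
qed

text \<open>The sample vector has a product law, so the deviation event is transported to the
  product space, where McDiarmid's inequality applies with all differences bounded by 2 / n. There
  the deviation is measured from the mean, which is at most
  \<open>alpha n p + beta n p\<close>.\<close>

theorem l1_dist_concentration:
  assumes "\<epsilon> > 0"
  shows "prob {\<omega> \<in> space M. l1_dist p X n \<omega> > alpha n p + beta n p + \<epsilon>} \<le> exp (- real n * \<epsilon>\<^sup>2 / 2)"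
proof -
  let ?C = "count_space {1..} :: nat measure"
  define I where "I = {1..n}"
  define N where "N = (\<lambda>_::nat. density ?C (\<lambda>j. ennreal (p j)))"
  define f where "f = l1_dist p (\<lambda>i x. x i) n"
  define S where "S \<omega> = (\<lambda>i\<in>I. X i \<omega>)" for \<omega>
  have "finite I" "I \<noteq> {}" "card I = n"
    using n by (auto simp: I_def)
  have distr_X: "distr M ?C (X i) = N i" if "i \<in> I" for i
    using distributed_distr_eq_density[OF distributed_X] that by (simp add: N_def I_def)
  \<comment> \<open>The product locale requires a probability measure at every index, also outside
    \<open>I\<close>. As \<open>N\<close> is constant, the law of \<open>X 1\<close> settles all of
    them.\<close>
  have "prob_space (N i)" for i
    using prob_space_distr[OF measurable_X[of 1]] distr_X[of 1] n by (simp add: I_def N_def)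
  then interpret N: product_prob_space N
    by (rule product_prob_spaceI)
  have meas_S: "S \<in> measurable M (Pi\<^sub>M I (\<lambda>_. ?C))"
    unfolding S_def by (rule measurable_restrict) (simp only: measurable_X I_def)
  have distr_S: "distr M (Pi\<^sub>M I (\<lambda>_. ?C)) S = Pi\<^sub>M I N"
  proof -
    have "distr M (Pi\<^sub>M I (\<lambda>_. ?C)) S = Pi\<^sub>M I (\<lambda>i. distr M ?C (X i))"
      unfolding S_def
    proof (rule indep_vars_iff_distr_eq_PiM'[THEN iffD1, OF \<open>I \<noteq> {}\<close>])
      show "X i \<in> measurable M ?C" if "i \<in> I" for i
        using that by (simp only: I_def measurable_X)
      show "indep_vars (\<lambda>_. ?C) X I"
        unfolding I_def by (rule indep_X)
    qed
    also have "\<dots> = Pi\<^sub>M I N"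
      by (rule PiM_cong[OF refl distr_X])
    finally show ?thesis .
  qed
  have f_S: "f (S \<omega>) = l1_dist p X n \<omega>" for \<omega>
    by (simp add: f_def S_def I_def l1_dist_def emp_freq_def)
  \<comment> \<open>A finite product of countable discrete spaces is discrete, so every function on
    it is measurable.\<close>
  have f[measurable]: "f \<in> borel_measurable (Pi\<^sub>M I (\<lambda>_. ?C))"
    by (simp add: count_space_PiM_finite[OF \<open>finite I\<close>])
  have f': "f \<in> borel_measurable (Pi\<^sub>M I N)"
    unfolding distr_S[symmetric] measurable_distr_eq1 by (rule f)
  have ge_1: "x i \<ge> 1" if "x \<in> space (Pi\<^sub>M I N)" "i \<in> {1..n}" for x i
    using that by (auto simp: space_PiM N_def I_def PiE_def Pi_def)
  have E: "(\<integral>x. f x \<partial>Pi\<^sub>M I N) = expectation (l1_dist p X n)"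
    unfolding distr_S[symmetric] integral_distr[OF meas_S f] f_S ..
  have set: "{x \<in> space (Pi\<^sub>M I (\<lambda>_. ?C)). f x \<ge> expectation (l1_dist p X n) + \<epsilon>}
      \<in> sets (Pi\<^sub>M I (\<lambda>_. ?C))"
    by measurable
  \<comment> \<open>With this value the McDiarmid exponent
    \<open>- 2 * \<epsilon>\<^sup>2 / (4 / real n)\<close> is the one claimed.\<close>
  have sum: "(\<Sum>i\<in>I. (2 / real n)\<^sup>2) = 4 / real n"
    using n by (simp add: \<open>card I = n\<close> power2_eq_square)
  have "prob {\<omega> \<in> space M. l1_dist p X n \<omega> > alpha n p + beta n p + \<epsilon>}
      \<le> prob {\<omega> \<in> space M. l1_dist p X n \<omega> \<ge> expectation (l1_dist p X n) + \<epsilon>}"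
    using expectation_l1_dist_le measurable_l1_dist by (intro finite_measure_mono) auto
  also have "\<dots> = measure (distr M (Pi\<^sub>M I (\<lambda>_. ?C)) S)
      {x \<in> space (Pi\<^sub>M I (\<lambda>_. ?C)). f x \<ge> expectation (l1_dist p X n) + \<epsilon>}"
    unfolding measure_distr[OF meas_S set]
    using measurable_space[OF meas_S] by (auto simp: f_S intro!: arg_cong[where f = prob])
  also have "\<dots> = measure (Pi\<^sub>M I N) {x \<in> space (Pi\<^sub>M I N). f x \<ge> (\<integral>x. f x \<partial>Pi\<^sub>M I N) + \<epsilon>}"
    unfolding E by (simp add: distr_S[symmetric])
  also have "\<dots> \<le> exp (- 2 * \<epsilon>\<^sup>2 / (\<Sum>i\<in>I. (2 / real n)\<^sup>2))"
  proof (rule N.McDiarmid_ineq[OF \<open>finite I\<close> f', where B = 2])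
    show "\<bar>f x\<bar> \<le> 2" if "x \<in> space (Pi\<^sub>M I N)" for x
      using l1_dist_le_2[OF p n, of "\<lambda>i x. x i" x] ge_1[OF that]
      by (auto simp: f_def l1_dist_def infsum_nonneg)
    show "\<bar>f x - f (x(i := y))\<bar> \<le> 2 / real n"
      if "x \<in> space (Pi\<^sub>M I N)" "i \<in> I" "y \<in> space (N i)" for x i y
      unfolding f_def by (rule l1_dist_bounded_difference[OF p n])
        (use ge_1[OF that(1)] that in \<open>auto simp: N_def I_def\<close>)
  qed (unfold sum, use n \<open>\<epsilon> > 0\<close> in auto)
  also have "\<dots> = exp (- real n * \<epsilon>\<^sup>2 / 2)"
    unfolding sum by simp
  finally show ?thesis .
qed

end

theorem theorem2p3:
  shows
    "(\<forall>p. distribution p \<longrightarrow>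
        (\<forall>n\<ge>1. \<forall>\<epsilon>>0. \<forall>(M :: 'a measure) X.
           prob_space M \<and> iid_sample M p n X \<longrightarrow>
             measure M {\<omega> \<in> space M. l1_dist p X n \<omega> > alpha n p + beta n p + \<epsilon>}
               \<le> exp (- real n * \<epsilon>\<^sup>2 / 2))) \<and>
     (\<forall>p. distribution p \<longrightarrow> (\<lambda>n. alpha n p + beta n p) \<longlonglongrightarrow> 0) \<and>
     (\<forall>r :: nat \<Rightarrow> real. r 1 < 1 \<and> strict_antimono_on {1..} r \<and> r \<longlonglongrightarrow> 0 \<longrightarrow>
        (\<exists>p. distribution p \<and> (\<forall>n\<ge>1. alpha n p + beta n p > r n)))"
proof (intro conjI allI impI)
  fix p n and \<epsilon> :: real and M :: "'a measure" and X
  assume "distribution p" "1 \<le> n" "0 < \<epsilon>" and "prob_space M \<and> iid_sample M p n X"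
  then interpret iid_sample_space M p n X
    by (intro iid_sample_space.intro iid_sample_space_axioms.intro) auto
  show "prob {\<omega> \<in> space M. l1_dist p X n \<omega> > alpha n p + beta n p + \<epsilon>}
      \<le> exp (- real n * \<epsilon>\<^sup>2 / 2)"
    by (rule l1_dist_concentration[OF \<open>0 < \<epsilon>\<close>])
next
  fix p assume "distribution p"
  then show "(\<lambda>n. alpha n p + beta n p) \<longlonglongrightarrow> 0"
    by (rule alpha_plus_beta_tendsto_0)
next
  fix r :: "nat \<Rightarrow> real"
  assume "r 1 < 1 \<and> strict_antimono_on {1..} r \<and> r \<longlonglongrightarrow> 0"
  then show "\<exists>p. distribution p \<and> (\<forall>n\<ge>1. alpha n p + beta n p > r n)"
    by (intro ex_distribution_alpha_beta_gt) auto
qed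

end
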